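(* Suppose $t\ge1$. Let $P_k,\hat\mu_k$ be the solutions of the forward recursion, for $k=0,\dots,t-1$, \begin{align*} E_{k+1} &= P_k^{-1} + {f^x_k}^T Q_{k+1}^{-1} f^x_k - \mu\bar\ell^{xx}_k,\\ \bar P_{k+1} &= Q_{k+1} + f^x_k\left(P_k^{-1}-\mu\bar\ell^{xx}_k\right)^{-1}{f^x_k}^T,\\ K_{k+1} &= \bar P_{k+1}{h^x_{k+1}}^T\left(R_{k+1}+h^x_{k+1}\bar P_{k+1}{h^x_{k+1}}^T\right)^{-1},\\ P_{k+1} &= (I_{n_x}-K_{k+1}h^x_{k+1})\bar P_{k+1},\\ \hat\mu_{k+1} &= (I_{n_x}-K_{k+1}h^x_{k+1})(f^x_k\hat\mu_k-w^i_{k+1}) + K_{k+1}\gamma^i_{k+1}\\ &\quad + \mu P_{k+1}Q_{k+1}^{-1}f^x_kE_{k+1}^{-1}\left(\bar\ell^{xx}_k\hat\mu_k+\ell^x_k\right), \end{align*} with initialization $P_0=P$, $\hat\mu_0=\hat x_0-x^i_0$, and assume that all the matrices inverted in this recursion are invertible. Then, for a vector $p=(p_{x_0},\dots,p_{x_T},p_{u_t},\dots,p_{u_{T-1}})$, the first $t\,n_x$ rows of the Newton system $\nabla^2J\,p=-\nabla J$ (i.e. the block rows corresponding to the variables $x_0,\dots,x_{t-1}$) hold if and only if, for all $k=0,\dots,t-1$, $$p_{x_k}=E_{k+1}^{-1}\left({f^x_k}^TQ_{k+1}^{-1}(w^i_{k+1}+p_{x_{k+1}})+P_k^{-1}\h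at\mu_k+\mu\ell^x_k\right).$$
   Context: Setting. Let $T\ge 1$ and $0\le t\le T$ be integers and $\mu>0$. States $x_j\in\mathbb R^{n_x}$, controls $u_j\in\mathbb R^{n_u}$, measurements $y_j\in\mathbb{R}^{n_y}$. The maps $f_j:\mathbb R^{n_x}\times\mathbb R^{n_u}\to\mathbb R^{n_x}$ ($0\le j<T$), $h_j:\mathbb R^{n_x}\to\mathbb R^{n_y}$ ($1\le j\le t$), $\ell_j:\mathbb R^{n_x}\times\mathbb R^{n_u}\to\mathbb R$ ($0\le j<T$), $\ell_T:\mathbb R^{n_x}\to\mathbb R$ are $\mathcal C^2$. The matrices $P$, $Q_j$ ($1\le j\le T$), $R_j$ ($1\le j\le t$) are symmetric positive definite. The past controls $u_0,\dots,u_{t-1}$, the measurements $y_1,\dots,y_t$ and the prior $\hat x_0$ are given and fixed. Define the function of the variables $x_{0:T}=(x_0,\dots,x_T)$ and $u_{t:T-1}=(u_t,\dots,u_{T-1})$ \begin{align*} J(x_{0:T},u_{t:T-1}) &= \sum_{j=0}^{T-1}\ell_j(x_j,u_j)+\ell_T(x_T) - \tfrac1{2\mu}(x_0-\hat x_0)^TP^{-1}(x_0-\hat x_0)\\ &\quad - \tfrac1{2\mu}\sum_{j=1}^t (y_j-h_j(x_j))^TR_j^{-1}(y_j-h_j(x_j))\\ &\quad - \tfrac1{2\mu}\sum_{j=0}^{T-1}(x_{j+1}-f_j(x_j,u_j))^TQ_{j+1}^{-1}(x_{j+1}-f_j(x_j,u_j)). \end{align*} Fix a current iterate $(x^i_{0:T},u^i_{t:T-1})$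 (with $u^i_k=u_k$ for $k<t$). All derivatives below, and $\nabla J,\nabla^2 J$, are evaluated at this iterate. The Newton step is $p=(p_{x_{0:T}},p_{u_{t:T-1}})$, with $p_{x_k}\in\mathbb R^{n_x}$, $p_{u_k}\in\mathbb R^{n_u}$, satisfying $\nabla^2 J\,p=-\nabla J$, with the variables ordered as $(x_0,\dots,x_T,u_t,\dots,u_{T-1})$. Notation. Superscripts denote derivatives: $f^x_k,h^x_k$ are Jacobian matrices; $\ell^x_k$ is a gradient column vector; $\ell^{xx}_k$ is the Hessian in $x$. Put $w^i_{k+1}=x^i_{k+1}-f_k(x^i_k,u^i_k)$ and $\gamma^i_k=y_k-h_k(x^i_k)$. For a vector $a$ and a vector-valued function $\phi$, $a^T\phi^{xx}=\sum_m a_m\phi_m^{xx}$ (weighted sum of the Hessians of the components). For $k<T$ define $$\bar\ell^{xx}_k=\ell^{xx}_k+\mu^{-1}{w^i_{k+1}}^TQ_{k+1}^{-1}f^{xx}_k+\mu^{-1}\mathbf 1_{1\le k\le t}\,{\gamma^i_k}^TR_k^{-1}h^{xx}_k.$$ *)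

theory Defs
  imports "HOL-Analysis.Analysis"
begin

definition C2 :: "('a::real_normed_vector \<Rightarrow> 'b::real_normed_vector) \<Rightarrow> bool" where
  "C2 g \<longleftrightarrow> (\<exists>(g' :: 'a \<Rightarrow> 'a \<Rightarrow>\<^sub>L 'b) (g'' :: 'a \<Rightarrow> 'a \<Rightarrow>\<^sub>L ('a \<Rightarrow>\<^sub>L 'b)).
     (\<forall>z. (g has_derivative blinfun_apply (g' z)) (at z)) \<and>
     (\<forall>z. (g' has_derivative blinfun_apply (g'' z)) (at z)) \<and>
     continuous_on UNIV g'')"

definition pos_def :: "real^'n^'n \<Rightarrow> bool" where
  "pos_def A \<longleftrightarrow> transpose A = A \<and> (\<forall>v. v \<noteq> 0 \<longrightarrow> 0 < v \<bullet> (A *v v))"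

definition grad :: "(real^'n \<Rightarrow> real) \<Rightarrow> real^'n \<Rightarrow> real^'n" where
  "grad g z = (\<chi> i. frechet_derivative g (at z) (axis i 1))"

text \<open>Row \<open>i\<close>, column \<open>j\<close> of the Hessian is the partial derivative in direction \<open>j\<close> of the
  \<open>i\<close>-th component of the gradient.\<close>

definition hessian :: "(real^'n \<Rightarrow> real) \<Rightarrow> real^'n \<Rightarrow> real^'n^'n" where
  "hessian g z = jacobian (grad g) (at z)"

definition weighted_hessian :: "real^'m \<Rightarrow> (real^'n \<Rightarrow> real^'m) \<Rightarrow> real^'n \<Rightarrow> real^'n^'n" where
  "weighted_hessian a g z = (\<Sum>m\<in>UNIV. (a $ m) *\<^sub>R hessian (\<lambda>v. g v $ m) z)"

text \<open>The argument \<open>u\<close> holds the fixed past controls (only \<open>u j\<close> with \<open>j < t\<close> is used) and \<open>v\<close> the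
  free controls (only \<open>v j\<close> with \<open>t \<le> j < T\<close> is used).\<close>

definition objective ::
  "nat \<Rightarrow> nat \<Rightarrow> real
   \<Rightarrow> (nat \<Rightarrow> (real^'n) \<times> (real^'m) \<Rightarrow> real^'n) \<Rightarrow> (nat \<Rightarrow> real^'n \<Rightarrow> real^'q)
   \<Rightarrow> (nat \<Rightarrow> (real^'n) \<times> (real^'m) \<Rightarrow> real) \<Rightarrow> (real^'n \<Rightarrow> real)
   \<Rightarrow> real^'n^'n \<Rightarrow> (nat \<Rightarrow> real^'n^'n) \<Rightarrow> (nat \<Rightarrow> real^'q^'q)
   \<Rightarrow> (nat \<Rightarrow> real^'m) \<Rightarrow> (nat \<Rightarrow> real^'q) \<Rightarrow> real^'n
   \<Rightarrow> (nat \<Rightarrow> real^'n) \<Rightarrow> (nat \<Rightarrow> real^'m) \<Rightarrow> real" where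
  "objective T t \<mu> f h l lT P Q R u y xhat0 x v =
    (let c = (\<lambda>j. if j < t then u j else v j) in
      (\<Sum>j<T. l j (x j, c j)) + lT (x T)
      - 1 / (2 * \<mu>) * ((x 0 - xhat0) \<bullet> (matrix_inv P *v (x 0 - xhat0)))
      - 1 / (2 * \<mu>) * (\<Sum>j = 1..t. (y j - h j (x j)) \<bullet> (matrix_inv (R j) *v (y j - h j (x j))))
      - 1 / (2 * \<mu>) * (\<Sum>j<T. (x (Suc j) - f j (x j, c j))
                               \<bullet> (matrix_inv (Q (Suc j)) *v (x (Suc j) - f j (x j, c j)))))"

text \<open>The number of scalar variables depends on \<open>T\<close> and \<open>t\<close>, so a point of the space of decision
  variables is a function on scalar coordinates: \<open>Xvar k i\<close> names the \<open>i\<close>-th component of \<open>x\<^sub>k\<close>,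
  and \<open>Uvar k i\<close> that of \<open>u\<^sub>k\<close>. Values outside \<open>decision_vars\<close> are irrelevant.\<close>

datatype ('n, 'm) var = Xvar nat 'n | Uvar nat 'm

definition decision_vars :: "nat \<Rightarrow> nat \<Rightarrow> ('n, 'm) var set" where
  "decision_vars T t = {Xvar k i |k i. k \<le> T} \<union> {Uvar k i |k i. t \<le> k \<and> k < T}"

fun pack :: "(nat \<Rightarrow> real^'n) \<Rightarrow> (nat \<Rightarrow> real^'m) \<Rightarrow> ('n, 'm) var \<Rightarrow> real" where
  "pack x u (Xvar k i) = x k $ i"
| "pack x u (Uvar k i) = u k $ i"

definition on_coords ::
  "((nat \<Rightarrow> real^'n) \<Rightarrow> (nat \<Rightarrow> real^'m) \<Rightarrow> real) \<Rightarrow> (('n, 'm) var \<Rightarrow> real) \<Rightarrow> real" where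
  "on_coords F z = F (\<lambda>k. \<chi> i. z (Xvar k i)) (\<lambda>k. \<chi> i. z (Uvar k i))"

definition partial_deriv :: "'v \<Rightarrow> (('v \<Rightarrow> real) \<Rightarrow> real) \<Rightarrow> ('v \<Rightarrow> real) \<Rightarrow> real" where
  "partial_deriv a F z = deriv (\<lambda>s. F (z(a := s))) (z a)"

text \<open>Row \<open>a\<close> of \<open>\<nabla>\<^sup>2F(z) p = -\<nabla>F(z)\<close>, for \<open>F\<close> as a function of the variables in \<open>V\<close>.\<close>

definition newton_row ::
  "'v set \<Rightarrow> (('v \<Rightarrow> real) \<Rightarrow> real) \<Rightarrow> ('v \<Rightarrow> real) \<Rightarrow> ('v \<Rightarrow> real) \<Rightarrow> 'v \<Rightarrow> bool" where
  "newton_row V F z p a \<longleftrightarrow>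
    (\<Sum>b\<in>V. partial_deriv b (partial_deriv a F) z * p b) = - partial_deriv a F z"

end

theory Submission
  imports Defs
begin

text \<open>The block row of the Newton system for \<open>x\<^sub>k\<close> couples only \<open>p\<^sub>k\<^sub>-\<^sub>1\<close>, \<open>p\<^sub>k\<close> and \<open>p\<^sub>k\<^sub>+\<^sub>1\<close>: the past
  controls are fixed and the free ones do not enter the gradient in \<open>x\<^sub>k\<close> for \<open>k < t\<close>. So the first
  \<open>t\<close> block rows are solved by block forward elimination. Two applications of the Woodbury identity
  turn the recursion into information form,
  \<open>P\<^sub>k\<^sub>+\<^sub>1\<inverse> = Q\<inverse> - Q\<inverse> F E\<inverse> F\<^sup>T Q\<inverse> + H\<^sup>T R\<inverse> H\<close> with \<open>E = E\<^sub>k\<^sub>+\<^sub>1\<close>, \<open>F = f\<^sup>x\<^sub>k\<close>, \<open>H = h\<^sup>x\<^sub>k\<^sub>+\<^sub>1\<close>, and this together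
  with the matching formula for \<open>P\<^sub>k\<^sub>+\<^sub>1\<inverse> \<mu>hat\<^sub>k\<^sub>+\<^sub>1\<close> is exactly what remains of row \<open>k + 1\<close> after
  \<open>p\<^sub>k\<close> has been eliminated.\<close>

section \<open>The Kalman recursion in information form\<close>

lemma matrix_inv_mult:
  fixes A :: "real^'n^'n"
  assumes "invertible A"
  shows "A ** matrix_inv A = mat 1" "matrix_inv A ** A = mat 1"
  using assms someI_ex[of "\<lambda>B. A ** B = mat 1 \<and> B ** A = mat 1"]
  by (auto simp: invertible_def matrix_inv_def)

lemma matrix_inv_mult_vector:
  fixes A :: "real^'n^'n"
  assumes "invertible A"
  shows "A *v (matrix_inv A *v x) = x" "matrix_inv A *v (A *v x) = x"
  using matrix_inv_mult[OF assms] by (simp_all add: matrix_vector_mul_assoc)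

text \<open>A one-sided inverse of a square matrix is two-sided, so one product computation settles
  invertibility and the value of the inverse for both factors.\<close>

lemma right_inverse_matrix_inv:
  fixes A B :: "real^'n^'n"
  assumes "A ** B = mat 1"
  shows "invertible A" "invertible B" "matrix_inv A = B" "matrix_inv B = A"
proof -
  have *: "invertible M \<and> matrix_inv M = N" if "M ** N = mat 1" for M N :: "real^'n^'n"
  proof -
    have inv: "invertible M"
      using that matrix_left_right_inverse[of M N] unfolding invertible_def by blast
    have "matrix_inv M = matrix_inv M ** (M ** N)"
      by (simp add: that)
    also have "\<dots> = N"
      using matrix_inv_mult[OF inv] by (simp add: matrix_mul_assoc)
    finally show ?thesis
      using inv by simp
  qed
  show "invertible A" "invertible B" "matrix_inv A = B" "matrix_inv B = A"
    using *[OF assms] *[of B A] assms matrix_left_right_inverse[of A B] by auto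
qed

lemma invertible_matrix_inv:
  fixes A :: "real^'n^'n"
  assumes "invertible A"
  shows "invertible (matrix_inv A)" "matrix_inv (matrix_inv A) = A"
  using right_inverse_matrix_inv matrix_inv_mult(1)[OF assms] by blast+

lemma pos_def_invertible:
  fixes A :: "real^'n^'n"
  assumes "pos_def A"
  shows "invertible A"
proof -
  have "v = 0" if "A *v v = 0" for v
    using assms that unfolding pos_def_def by (metis inner_zero_right less_irrefl)
  then obtain B where "B ** A = mat 1"
    using matrix_left_invertible_ker[of A] by blast
  then show ?thesis
    using right_inverse_matrix_inv(2) by blast
qed

text \<open>Transposing \<open>matrix_inv A ** A = mat 1\<close> exhibits the transposed inverse as
  a right inverse of the symmetric \<open>A\<close>, and right inverses are unique.\<close>

lemma pos_def_inv_symmetric: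
  fixes A :: "real^'n^'n"
  assumes "pos_def A"
  shows "transpose (matrix_inv A) = matrix_inv A"
proof -
  have "A ** transpose (matrix_inv A) = transpose (matrix_inv A ** A)"
    using assms by (simp add: pos_def_def matrix_transpose_mul)
  then have "A ** transpose (matrix_inv A) = mat 1"
    by (simp add: matrix_inv_mult pos_def_invertible[OF assms])
  then show ?thesis
    using right_inverse_matrix_inv(3) by metis
qed

text \<open>Both directions get used: the first two conclusions invert the sum that defines
  \<open>Pbar\<close>, the last two invert the difference that defines the corrected
  covariance.\<close>

lemma woodbury:
  fixes A :: "real^'n^'n" and C :: "real^'m^'m" and U :: "real^'m^'n" and V :: "real^'n^'m"
  assumes A: "invertible A" and C: "invertible C" and S: "invertible (C + V ** matrix_inv A ** U)"
  defines "B \<equiv> matrix_inv A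
             - matrix_inv A ** U ** matrix_inv (C + V ** matrix_inv A ** U) ** V ** matrix_inv A"
  shows "invertible (A + U ** matrix_inv C ** V)" "matrix_inv (A + U ** matrix_inv C ** V) = B"
    "invertible B" "matrix_inv B = A + U ** matrix_inv C ** V"
proof -
  define S where "S = C + V ** matrix_inv A ** U"
  \<comment> \<open>Reading \<open>V A^-1 U\<close> as \<open>S - C\<close> makes \<open>S\<close>
    and \<open>C\<close> meet their own inverses, so that everything but the identity
    cancels.\<close>
  have VAU: "V *v (matrix_inv A *v (U *v x)) = S *v x - C *v x" for x
    by (simp add: S_def algebra_simps matrix_vector_mul_assoc matrix_mul_assoc)
  have "(A + U ** matrix_inv C ** V) ** B = mat 1"
    unfolding matrix_eq B_def S_def[symmetric]
    by (simp add: matrix_vector_mul_assoc[symmetric] algebra_simps VAU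
        matrix_inv_mult_vector[OF A] matrix_inv_mult_vector[OF C]
        matrix_inv_mult_vector[OF S[folded S_def]])
  then show "invertible (A + U ** matrix_inv C ** V)" "matrix_inv (A + U ** matrix_inv C ** V) = B"
    "invertible B" "matrix_inv B = A + U ** matrix_inv C ** V"
    using right_inverse_matrix_inv by blast+
qed

text \<open>One step of the recursion with generic names: \<open>L\<close> stands for
  \<open>lbar_xx k\<close>, \<open>a\<close> and \<open>b\<close> for \<open>\<mu>hat k\<close> and
  \<open>\<mu>hat (k + 1)\<close>, \<open>c\<close> for \<open>lx k\<close>. The gain
  \<open>K\<close> disappears from both right-hand sides, which makes them comparable with a Newton
  row.\<close>

lemma kalman_information_step:
  fixes P Q L F E Pbar P' :: "real^'n^'n" and R :: "real^'q^'q" and H :: "real^'n^'q"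
    and K :: "real^'q^'n" and \<mu> :: real and a b c w :: "real^'n" and \<gamma> :: "real^'q"
  assumes Q: "invertible Q" and R: "invertible R"
    and PL: "invertible (matrix_inv P - \<mu> *\<^sub>R L)" and E: "invertible E"
    and S: "invertible (R + H ** Pbar ** transpose H)"
    and E_eq: "E = matrix_inv P + transpose F ** matrix_inv Q ** F - \<mu> *\<^sub>R L"
    and Pbar_eq: "Pbar = Q + F ** matrix_inv (matrix_inv P - \<mu> *\<^sub>R L) ** transpose F"
    and K_eq: "K = Pbar ** transpose H ** matrix_inv (R + H ** Pbar ** transpose H)"
    and P'_eq: "P' = (mat 1 - K ** H) ** Pbar"
    and b_eq: "b = (mat 1 - K ** H) *v (F *v a - w) + K *v \<gamma>
          + \<mu> *\<^sub>R ((P' ** matrix_inv Q ** F ** matrix_inv E) *v (L *v a + c))"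
  shows "matrix_inv P' = matrix_inv Q
      - matrix_inv Q ** F ** matrix_inv E ** transpose F ** matrix_inv Q
      + transpose H ** matrix_inv R ** H" (is ?P)
    and "matrix_inv P' *v b = transpose H *v (matrix_inv R *v \<gamma>) - matrix_inv Q *v w
      + matrix_inv Q *v (F *v (matrix_inv E *v
          (transpose F *v (matrix_inv Q *v w) + matrix_inv P *v a + \<mu> *\<^sub>R c)))" (is ?b)
proof -
  define A where "A = matrix_inv P - \<mu> *\<^sub>R L"
  have E_A: "E = A + transpose F ** matrix_inv Q ** F"
    by (simp add: E_eq A_def)
  \<comment> \<open>Prediction: with base matrix \<open>Q\<close> and inner matrix \<open>A\<close>,
    the matrix inverted in the Woodbury formula is exactly \<open>E\<close>.\<close>
  have Pbar: "invertible Pbar" and Pbar_inv: "matrix_inv Pbar = matrix_inv Q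
      - matrix_inv Q ** F ** matrix_inv E ** transpose F ** matrix_inv Q"
    using woodbury[of Q A "transpose F" F] Q PL E unfolding E_A Pbar_eq A_def by auto
  define S where "S = R + H ** Pbar ** transpose H"
  have P'_S: "P' = Pbar - Pbar ** transpose H ** matrix_inv S ** H ** Pbar"
    unfolding P'_eq K_eq S_def[symmetric] matrix_eq
    by (simp add: matrix_vector_mul_assoc[symmetric] algebra_simps del: transpose_matrix_vector)
  \<comment> \<open>Correction: the base matrix is now \<open>matrix_inv Pbar\<close> and the inner
    one \<open>R\<close>. \<open>P'\<close> is the difference side of the identity, so its inverse
    is a plain sum.\<close>
  have P': "invertible P'"
    and P'_inv: "matrix_inv P' = matrix_inv Pbar + transpose H ** matrix_inv R ** H"
    using woodbury[of "matrix_inv Pbar" R H "transpose H"] invertible_matrix_inv[OF Pbar] R S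
    unfolding P'_S S_def by auto
  show ?P
    unfolding P'_inv Pbar_inv by simp
  have HPH: "H *v (Pbar *v (transpose H *v x)) = S *v x - R *v x" for x
    by (simp add: S_def algebra_simps matrix_vector_mul_assoc matrix_mul_assoc
        del: transpose_matrix_vector)
  \<comment> \<open>The gain in information form:
    \<open>(Pbar^-1 + H^T R^-1 H) Pbar H^T = H^T R^-1 S\<close>, and \<open>S\<close> cancels the
    inverse inside \<open>K\<close>.\<close>
  have P'K: "matrix_inv P' *v (K *v x) = transpose H *v (matrix_inv R *v x)" for x
    unfolding P'_inv K_eq S_def[symmetric]
    by (simp add: matrix_vector_mul_assoc[symmetric] algebra_simps HPH
        matrix_inv_mult_vector[OF Pbar] matrix_inv_mult_vector[OF R]
        matrix_inv_mult_vector[OF S[folded S_def]] del: transpose_matrix_vector)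
  have P'I: "matrix_inv P' *v ((mat 1 - K ** H) *v x) = matrix_inv Pbar *v x" for x
  proof -
    have "(mat 1 - K ** H) *v x = P' *v (matrix_inv Pbar *v x)"
      by (simp add: P'_eq matrix_vector_mul_assoc[symmetric] matrix_inv_mult_vector[OF Pbar])
    then show ?thesis
      by (simp add: matrix_inv_mult_vector[OF P'])
  qed
  \<comment> \<open>Substituted into \<open>Pbar^-1 F a\<close>, this lets \<open>E\<close> cancel
    its inverse. The remaining \<open>\<mu> L a\<close> term is removed by the \<open>L a\<close>
    part of the last summand of \<open>b_eq\<close>.\<close>
  have FQF: "transpose F *v (matrix_inv Q *v (F *v x))
      = E *v x - matrix_inv P *v x + \<mu> *\<^sub>R (L *v x)" for x
    by (simp add: E_eq algebra_simps matrix_vector_mul_assoc matrix_mul_assoc scaleR_matrix_vector_assoc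
        del: transpose_matrix_vector)
  have "matrix_inv P' *v b = matrix_inv Pbar *v (F *v a - w) + transpose H *v (matrix_inv R *v \<gamma>)
      + \<mu> *\<^sub>R (matrix_inv Q *v (F *v (matrix_inv E *v (L *v a + c))))"
    by (simp add: b_eq matrix_vector_right_distrib matrix_vector_mult_scaleR P'I P'K
        matrix_inv_mult_vector[OF P'] del: transpose_matrix_vector flip: matrix_vector_mul_assoc)
  then show ?b
    by (simp add: Pbar_inv algebra_simps matrix_inv_mult_vector[OF E] FQF
        del: transpose_matrix_vector flip: matrix_vector_mul_assoc)
qed

section \<open>Gradients and Hessians of twice differentiable maps\<close>

lemma C2_bounded_linear_left:
  fixes g :: "'a::real_normed_vector \<Rightarrow> 'b::real_normed_vector" and \<pi> :: "'b \<Rightarrow> 'c::real_normed_vector"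
  assumes "C2 g" and pi: "bounded_linear \<pi>"
  shows "C2 (\<lambda>x. \<pi> (g x))"
proof -
  obtain g' g'' where g: "\<And>z. (g has_derivative blinfun_apply (g' z)) (at z)"
      "\<And>z. (g' has_derivative blinfun_apply (g'' z)) (at z)" "continuous_on UNIV g''"
    using assms(1) unfolding C2_def by blast
  define p where "p = Blinfun \<pi>"
  have p: "blinfun_apply p = \<pi>"
    by (simp add: p_def bounded_linear_Blinfun_apply pi)
  \<comment> \<open>First derivatives live in a space of operators. Composition with
    \<open>p\<close> must itself be a bounded linear map on that space before it can act on
    \<open>g''\<close>.\<close>
  define q where "q = Blinfun (\<lambda>M :: 'a \<Rightarrow>\<^sub>L 'b. p o\<^sub>L M)"
  have lin: "bounded_linear (\<lambda>M :: 'a \<Rightarrow>\<^sub>L 'b. p o\<^sub>L M)"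
    by (rule bounded_bilinear.bounded_linear_right[OF bounded_bilinear_blinfun_compose])
  have q: "blinfun_apply q = (\<lambda>M. p o\<^sub>L M)"
    unfolding q_def by (rule bounded_linear_Blinfun_apply[OF lin])
  show ?thesis
    unfolding C2_def
  proof (intro exI conjI allI)
    show "((\<lambda>x. \<pi> (g x)) has_derivative blinfun_apply (p o\<^sub>L g' z)) (at z)" for z
      using bounded_linear.has_derivative[OF pi g(1)[of z]] by (simp add: p o_def blinfun_compose.rep_eq)
    show "((\<lambda>z. p o\<^sub>L g' z) has_derivative blinfun_apply (q o\<^sub>L g'' z)) (at z)" for z
      using bounded_linear.has_derivative[OF lin g(2)[of z]] by (simp add: q o_def blinfun_compose.rep_eq)
    show "continuous_on UNIV (\<lambda>z. q o\<^sub>L g'' z)"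
      by (intro continuous_intros g(3))
  qed
qed

text \<open>The translation is there for freezing a control: \<open>x\<close> is sent to
  \<open>(0, c) + (x, 0)\<close>, which is affine.\<close>

lemma C2_affine:
  fixes g :: "'a::real_normed_vector \<Rightarrow> 'b::real_normed_vector" and L :: "'c::real_normed_vector \<Rightarrow> 'a"
  assumes "C2 g" and L: "bounded_linear L"
  shows "C2 (\<lambda>x. g (a + L x))"
proof -
  obtain g' g'' where g: "\<And>z. (g has_derivative blinfun_apply (g' z)) (at z)"
      "\<And>z. (g' has_derivative blinfun_apply (g'' z)) (at z)" "continuous_on UNIV g''"
    using assms(1) unfolding C2_def by blast
  define p where "p = Blinfun L"
  have p: "blinfun_apply p = L"
    by (simp add: p_def bounded_linear_Blinfun_apply L)
  define q where "q = Blinfun (\<lambda>M :: 'a \<Rightarrow>\<^sub>L 'b. M o\<^sub>L p)"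
  have lin: "bounded_linear (\<lambda>M :: 'a \<Rightarrow>\<^sub>L 'b. M o\<^sub>L p)"
    by (rule bounded_bilinear.bounded_linear_left[OF bounded_bilinear_blinfun_compose])
  have q: "blinfun_apply q = (\<lambda>M. M o\<^sub>L p)"
    unfolding q_def by (rule bounded_linear_Blinfun_apply[OF lin])
  have aff: "((\<lambda>x. a + L x) has_derivative L) (at z)" for z
    using has_derivative_add[OF has_derivative_const bounded_linear_imp_has_derivative[OF L]] by simp
  show ?thesis
    unfolding C2_def
  proof (intro exI conjI allI)
    show "((\<lambda>x. g (a + L x)) has_derivative blinfun_apply (g' (a + L z) o\<^sub>L p)) (at z)" for z
      using diff_chain_at[OF aff g(1)] by (simp add: p o_def blinfun_compose.rep_eq)
    have "((\<lambda>z. g' (a + L z)) has_derivative blinfun_apply (g'' (a + L z) o\<^sub>L p)) (at z)" for z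
      using diff_chain_at[OF aff g(2)] by (simp add: p o_def blinfun_compose.rep_eq)
    from bounded_linear.has_derivative[OF lin this]
    show "((\<lambda>z. g' (a + L z) o\<^sub>L p) has_derivative
        blinfun_apply (q o\<^sub>L (g'' (a + L z) o\<^sub>L p))) (at z)" for z
      by (simp add: q o_def blinfun_compose.rep_eq)
    have "continuous_on UNIV (\<lambda>x. g'' (a + L x))"
      by (rule continuous_on_compose2[OF g(3)])
        (auto intro!: continuous_intros bounded_linear.continuous_on[OF L])
    then show "continuous_on UNIV (\<lambda>z. q o\<^sub>L (g'' (a + L z) o\<^sub>L p))"
      by (intro continuous_intros)
  qed
qed

lemma C2_fix_snd:
  assumes "C2 g"
  shows "C2 (\<lambda>x. g (x, c))"
proof -
  have "bounded_linear (\<lambda>x. (x, 0))"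
    by (intro bounded_linear_Pair bounded_linear_ident bounded_linear_zero)
  from C2_affine[OF assms this, of "(0, c)"] show ?thesis
    by simp
qed

section \<open>Derivatives expressed by gradients, Jacobians and Hessians\<close>

lemma C2_differentiable: "C2 g \<Longrightarrow> g differentiable (at z)"
  unfolding C2_def differentiable_def by blast

lemma C2_has_derivative_jacobian:
  fixes \<phi> :: "real^'n \<Rightarrow> real^'m"
  assumes "C2 \<phi>"
  shows "(\<phi> has_derivative (\<lambda>d. jacobian \<phi> (at z) *v d)) (at z)"
  using C2_differentiable[OF assms] jacobian_works by blast

lemma has_derivative_vec_lambda:
  fixes g :: "'a::real_normed_vector \<Rightarrow> 'i::finite \<Rightarrow> real"
  assumes "\<And>i. ((\<lambda>z. g z i) has_derivative (\<lambda>d. g' d i)) (at z)"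
  shows "((\<lambda>z. \<chi> i. g z i) has_derivative (\<lambda>d. \<chi> i. g' d i)) (at z)"
  using assms
  by (subst has_derivative_componentwise_within) (auto simp: Basis_vec_def inner_axis)

lemma frechet_derivative_eq_grad:
  fixes \<phi> :: "real^'n \<Rightarrow> real"
  assumes "\<phi> differentiable (at z)"
  shows "frechet_derivative \<phi> (at z) = (\<lambda>d. grad \<phi> z \<bullet> d)"
proof
  fix d :: "real^'n"
  interpret linear "frechet_derivative \<phi> (at z)"
    using assms by (rule linear_frechet_derivative)
  have "frechet_derivative \<phi> (at z) d = frechet_derivative \<phi> (at z) (\<Sum>i\<in>UNIV. d $ i *\<^sub>R axis i 1)"
    using basis_expansion[of d] by (simp add: scalar_mult_eq_scaleR)
  also have "\<dots> = grad \<phi> z \<bullet> d"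
    by (simp add: sum scaleR grad_def inner_vec_def mult.commute)
  finally show "frechet_derivative \<phi> (at z) d = grad \<phi> z \<bullet> d" .
qed

lemma C2_has_derivative_grad:
  fixes \<phi> :: "real^'n \<Rightarrow> real"
  assumes "C2 \<phi>"
  shows "(\<phi> has_derivative (\<lambda>d. grad \<phi> z \<bullet> d)) (at z)"
  using C2_differentiable[OF assms, of z] frechet_derivative_eq_grad frechet_derivative_works by metis

text \<open>\<open>hessian\<close> is the Jacobian of \<open>grad\<close>, so only differentiability
  of \<open>grad\<close> is at stake. Its components are the operator \<open>g'\<close> evaluated at
  axis vectors, and evaluation is bounded linear.\<close>

lemma C2_grad_has_derivative_hessian:
  fixes \<phi> :: "real^'n \<Rightarrow> real"
  assumes "C2 \<phi>"
  shows "(grad \<phi> has_derivative (\<lambda>d. hessian \<phi> z *v d)) (at z)"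
proof -
  obtain g' g'' where g: "\<And>z. (\<phi> has_derivative blinfun_apply (g' z)) (at z)"
      "\<And>z. (g' has_derivative blinfun_apply (g'' z)) (at z)"
    using assms(1) unfolding C2_def by blast
  have "grad \<phi> = (\<lambda>z. \<chi> i. blinfun_apply (g' z) (axis i 1))"
    unfolding grad_def using frechet_derivative_at[OF g(1)] by (simp add: fun_eq_iff)
  moreover have "((\<lambda>z. \<chi> i. blinfun_apply (g' z) (axis i 1)) has_derivative
      (\<lambda>d. \<chi> i. blinfun_apply (blinfun_apply (g'' z) d) (axis i 1))) (at z)"
    by (intro has_derivative_vec_lambda
        bounded_linear.has_derivative[OF blinfun.bounded_linear_left] g(2))
  ultimately have "grad \<phi> differentiable (at z)"
    unfolding differentiable_def by auto
  then show ?thesis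
    unfolding hessian_def using jacobian_works by blast
qed

lemma C2_component:
  fixes \<phi> :: "'a::real_normed_vector \<Rightarrow> real^'m"
  assumes "C2 \<phi>"
  shows "C2 (\<lambda>v. \<phi> v $ m)"
  using C2_bounded_linear_left[OF assms bounded_linear_vec_nth] .

lemma jacobian_row_eq_grad:
  fixes \<phi> :: "real^'n \<Rightarrow> real^'m"
  assumes "\<phi> differentiable (at z)"
  shows "jacobian \<phi> (at z) $ m = grad (\<lambda>v. \<phi> v $ m) z"
proof -
  have "((\<lambda>v. \<phi> v $ m) has_derivative (\<lambda>d. frechet_derivative \<phi> (at z) d $ m)) (at z)"
    using assms frechet_derivative_works
    by (intro bounded_linear.has_derivative[OF bounded_linear_vec_nth]) blast
  from frechet_derivative_at[OF this] show ?thesis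
    by (simp add: jacobian_def matrix_def grad_def vec_eq_iff fun_eq_iff)
qed

text \<open>Symmetry of \<open>M\<close> merges the two terms of the product rule. The resulting
  factor 2 cancels the one in \<open>1 / (2 * \<mu>)\<close>.\<close>

lemma has_derivative_quadratic_form:
  fixes r :: "'a::real_normed_vector \<Rightarrow> real^'m"
  assumes r: "(r has_derivative r') (at z)" and M: "transpose M = M"
  shows "((\<lambda>\<xi>. r \<xi> \<bullet> (M *v r \<xi>)) has_derivative (\<lambda>d. 2 * (r' d \<bullet> (M *v r z)))) (at z)"
proof -
  have sym: "a \<bullet> (M *v b) = b \<bullet> (M *v a)" for a b
    using dot_lmul_matrix[of a M b] transpose_matrix_vector[of M a] M by (simp add: inner_commute)
  have "((\<lambda>\<xi>. r \<xi> \<bullet> (M *v r \<xi>)) has_derivative (\<lambda>d. r z \<bullet> (M *v r' d) + r' d \<bullet> (M *v r z))) (at z)"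
    by (intro has_derivative_inner r bounded_linear.has_derivative[OF matrix_vector_mul_bounded_linear])
  then show ?thesis
    by (simp add: sym[of "r z"])
qed

text \<open>The left side is a sum of component gradients whose weights depend on the point.
  Differentiating the gradients gives the weighted Hessian, the source of the curvature terms in
  \<open>lbar_xx\<close>; differentiating the weights gives the Gauss-Newton term.\<close>

lemma has_derivative_weighted_residual:
  fixes \<phi> :: "real^'n \<Rightarrow> real^'m"
  assumes "C2 \<phi>"
  shows "((\<lambda>\<xi>. transpose (jacobian \<phi> (at \<xi>)) *v (M *v (c - \<phi> \<xi>))) has_derivative
     (\<lambda>d. weighted_hessian (M *v (c - \<phi> z)) \<phi> z *v d
        - transpose (jacobian \<phi> (at z)) *v (M *v (jacobian \<phi> (at z) *v d)))) (at z)"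
proof -
  have expand: "transpose (jacobian \<phi> (at \<xi>)) *v v = (\<Sum>m\<in>UNIV. v $ m *\<^sub>R grad (\<lambda>v. \<phi> v $ m) \<xi>)"
    for \<xi> v
    unfolding jacobian_row_eq_grad[OF C2_differentiable[OF assms], symmetric]
    by (simp add: vec_eq_iff matrix_vector_mult_def transpose_def mult.commute
        del: transpose_matrix_vector)
  have r: "((\<lambda>\<xi>. (M *v (c - \<phi> \<xi>)) $ m) has_derivative (\<lambda>d. (M *v (- (jacobian \<phi> (at z) *v d))) $ m))
      (at z)" for m
    by (intro bounded_linear.has_derivative[OF bounded_linear_vec_nth]
        bounded_linear.has_derivative[OF matrix_vector_mul_bounded_linear])
      (auto intro!: derivative_eq_intros C2_has_derivative_jacobian assms)
  have "((\<lambda>\<xi>. \<Sum>m\<in>UNIV. (M *v (c - \<phi> \<xi>)) $ m *\<^sub>R grad (\<lambda>v. \<phi> v $ m) \<xi>) has_derivative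
     (\<lambda>d. \<Sum>m\<in>UNIV. (M *v (c - \<phi> z)) $ m *\<^sub>R (hessian (\<lambda>v. \<phi> v $ m) z *v d)
        + (M *v (- (jacobian \<phi> (at z) *v d))) $ m *\<^sub>R grad (\<lambda>v. \<phi> v $ m) z)) (at z)"
    by (intro has_derivative_sum has_derivative_scaleR r C2_grad_has_derivative_hessian
        C2_component assms)
  moreover have "(\<Sum>m\<in>UNIV. a $ m *\<^sub>R (hessian (\<lambda>v. \<phi> v $ m) z *v d)) = weighted_hessian a \<phi> z *v d"
    for a d
  proof -
    have "linear (\<lambda>A :: real^'n^'n. A *v d)"
      by (rule linearI) (simp_all add: matrix_vector_mult_add_rdistrib scaleR_matrix_vector_assoc)
    from linear_sum[OF this, of "\<lambda>m. a $ m *\<^sub>R hessian (\<lambda>v. \<phi> v $ m) z" UNIV] show ?thesis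
      by (simp add: weighted_hessian_def scaleR_matrix_vector_assoc)
  qed
  ultimately show ?thesis
    unfolding expand
    by (simp add: sum_subtractf linear_neg matrix_vector_mul_linear sum_negf
         del: transpose_matrix_vector)
qed

section \<open>Block rows of the Newton system\<close>

text \<open>Varying one scalar coordinate moves \<open>x k\<close> along an axis at unit speed, so
  the chain rule reduces the partial derivative to the derivative in the block
  \<open>x k\<close>.\<close>

lemma partial_deriv_Xvar:
  fixes F :: "(nat \<Rightarrow> real^'n) \<Rightarrow> (nat \<Rightarrow> real^'m) \<Rightarrow> real" and z :: "('n, 'm) var \<Rightarrow> real"
  defines "x \<equiv> \<lambda>k. \<chi> i. z (Xvar k i)" and "v \<equiv> \<lambda>k. \<chi> i. z (Uvar k i)"
  assumes D: "((\<lambda>\<xi>. F (x(k := \<xi>)) v) has_derivative D) (at (x k))"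
  shows "partial_deriv (Xvar k i) (on_coords F) z = D (axis i 1)"
proof -
  have upd: "on_coords F (z(Xvar k i := s))
      = F (x(k := x k + (s - z (Xvar k i)) *\<^sub>R axis i 1)) v" for s
    unfolding on_coords_def
    by (rule arg_cong2[of _ _ _ _ F]) (auto simp: x_def v_def fun_eq_iff vec_eq_iff axis_def)
  have "((\<lambda>s. x k + (s - z (Xvar k i)) *\<^sub>R axis i 1) has_derivative (\<lambda>s. s *\<^sub>R axis i 1))
      (at (z (Xvar k i)))"
    by (auto intro!: derivative_eq_intros)
  moreover have "((\<lambda>\<xi>. F (x(k := \<xi>)) v) has_derivative D)
      (at (x k + (z (Xvar k i) - z (Xvar k i)) *\<^sub>R axis i 1))"
    using D by simp
  ultimately have "((\<lambda>s. on_coords F (z(Xvar k i := s))) has_derivative (\<lambda>s. D (s *\<^sub>R axis i 1)))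
      (at (z (Xvar k i)))"
    unfolding upd by (rule has_derivative_compose)
  moreover have "D (s *\<^sub>R axis i 1) = D (axis i 1) * s" for s
    using linear_scale[OF has_derivative_linear[OF D]] by simp
  ultimately show ?thesis
    unfolding partial_deriv_def by (intro DERIV_imp_deriv) (simp add: has_field_derivative_def)
qed

lemma partial_deriv_Uvar_eq_0:
  assumes "\<And>x v a. F x (v(k := a)) = F x v"
  shows "partial_deriv (Uvar k i) (on_coords F) z = 0"
proof -
  have "on_coords F (z(Uvar k i := s)) = on_coords F z" for s
  proof -
    let ?v = "\<lambda>w k. \<chi> i. w (Uvar k i)"
    \<comment> \<open>The assumption replaces a whole control vector, so the update of one component
      is recast as such a replacement.\<close>
    have "?v (z(Uvar k i := s)) = (?v z)(k := ?v (z(Uvar k i := s)) k)"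
      by (auto simp: fun_eq_iff vec_eq_iff)
    then show ?thesis
      using assms[of _ "?v z" "?v (z(Uvar k i := s)) k"] by (simp add: on_coords_def)
  qed
  then show ?thesis
    by (simp add: partial_deriv_def)
qed

lemma sum_decision_vars:
  fixes g :: "('n::finite, 'm::finite) var \<Rightarrow> real"
  assumes "\<And>k i. t \<le> k \<Longrightarrow> k < T \<Longrightarrow> g (Uvar k i) = 0"
  shows "sum g (decision_vars T t) = (\<Sum>k\<le>T. \<Sum>i\<in>UNIV. g (Xvar k i))"
proof -
  let ?X = "(\<lambda>(k, i). Xvar k i) ` ({..T} \<times> UNIV) :: ('n, 'm) var set"
  let ?U = "(\<lambda>(k, i). Uvar k i) ` ({t..<T} \<times> UNIV) :: ('n, 'm) var set"
  have "decision_vars T t = ?X \<union> ?U"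
    by (auto simp: decision_vars_def image_iff)
  moreover have "sum g (?X \<union> ?U) = sum g ?X + sum g ?U"
    by (rule sum.union_disjoint) auto
  moreover have "sum g ?U = 0"
    using assms by (intro sum.neutral) auto
  moreover have "sum g ?X = (\<Sum>k\<le>T. \<Sum>i\<in>UNIV. g (Xvar k i))"
    by (subst sum.reindex) (auto simp: inj_on_def sum.cartesian_product o_def case_prod_unfold)
  ultimately show ?thesis
    by simp
qed

text \<open>The gradient \<open>G\<close> depends on the states alone, which kills the control
  columns of the row. \<open>F\<close> is assumed at all points because the first partial derivative
  is differentiated again.\<close>

lemma newton_row_Xvar:
  fixes F :: "(nat \<Rightarrow> real^'n) \<Rightarrow> (nat \<Rightarrow> real^'m) \<Rightarrow> real" and G :: "(nat \<Rightarrow> real^'n) \<Rightarrow> real^'n"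
  assumes F: "\<And>x v. ((\<lambda>\<xi>. F (x(k := \<xi>)) v) has_derivative (\<lambda>d. G x \<bullet> d)) (at (x k))"
    and G: "\<And>j. j \<le> T \<Longrightarrow> ((\<lambda>\<xi>. G (x(j := \<xi>))) has_derivative H j) (at (x j))"
  shows "newton_row (decision_vars T t) (on_coords F) (pack x v) (pack px pu) (Xvar k i)
      \<longleftrightarrow> (\<Sum>j\<le>T. H j (px j)) $ i = (- G x) $ i"
proof -
  \<comment> \<open>This is an equality of functions, not of values at the iterate, so it can be
    substituted under the second partial derivative.\<close>
  have first: "partial_deriv (Xvar k i) (on_coords F) = on_coords (\<lambda>x v. G x $ i)"
  proof
    fix z :: "('n, 'm) var \<Rightarrow> real"
    show "partial_deriv (Xvar k i) (on_coords F) z = on_coords (\<lambda>x v. G x $ i) z"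
      by (subst partial_deriv_Xvar[OF F]) (simp add: on_coords_def inner_axis)
  qed
  have U: "partial_deriv (Uvar j a) (on_coords (\<lambda>x v. G x $ i)) (pack x v) = 0" for j a
    by (rule partial_deriv_Uvar_eq_0) simp
  have X: "partial_deriv (Xvar j a) (on_coords (\<lambda>x v. G x $ i)) (pack x v) = H j (axis a 1) $ i"
    if "j \<le> T" for j a
    using bounded_linear.has_derivative[OF bounded_linear_vec_nth G[OF that]]
    by (intro partial_deriv_Xvar) (simp only: pack.simps vec_nth_inverse)
  have lin: "H j d $ i = (\<Sum>a\<in>UNIV. H j (axis a 1) $ i * d $ a)" if "j \<le> T" for j d
  proof -
    interpret linear "H j"
      using G[OF that] by (rule has_derivative_linear)
    have "H j d = H j (\<Sum>a\<in>UNIV. d $ a *\<^sub>R axis a 1)"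
      using basis_expansion[of d] by (simp add: scalar_mult_eq_scaleR)
    then show ?thesis
      by (simp add: sum scale mult.commute)
  qed
  have "(\<Sum>b\<in>decision_vars T t.
      partial_deriv b (on_coords (\<lambda>x v. G x $ i)) (pack x v) * pack px pu b)
      = (\<Sum>j\<le>T. H j (px j)) $ i"
    by (subst sum_decision_vars) (simp_all add: U X lin)
  then show ?thesis
    unfolding newton_row_def first by (simp add: on_coords_def)
qed

text \<open>The gradient of \<open>objective\<close> in \<open>x k\<close> for \<open>k < t\<close>.
  Stages \<open>k\<close> and \<open>k - 1\<close> both use past controls, so only \<open>u\<close>
  appears. At \<open>k = 0\<close> the prior replaces the measurement and the incoming
  dynamics.\<close>

definition state_gradient ::
  "nat \<Rightarrow> real
   \<Rightarrow> (nat \<Rightarrow> (real^'n) \<times> (real^'m) \<Rightarrow> real^'n) \<Rightarrow> (nat \<Rightarrow> real^'n \<Rightarrow> real^'q)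
   \<Rightarrow> (nat \<Rightarrow> (real^'n) \<times> (real^'m) \<Rightarrow> real)
   \<Rightarrow> real^'n^'n \<Rightarrow> (nat \<Rightarrow> real^'n^'n) \<Rightarrow> (nat \<Rightarrow> real^'q^'q)
   \<Rightarrow> (nat \<Rightarrow> real^'m) \<Rightarrow> (nat \<Rightarrow> real^'q) \<Rightarrow> real^'n
   \<Rightarrow> (nat \<Rightarrow> real^'n) \<Rightarrow> real^'n" where
  "state_gradient k \<mu> f h l P Q R u y xhat0 x =
    grad (\<lambda>\<xi>. l k (\<xi>, u k)) (x k)
    + (1 / \<mu>) *\<^sub>R (transpose (jacobian (\<lambda>\<xi>. f k (\<xi>, u k)) (at (x k)))
                 *v (matrix_inv (Q (Suc k)) *v (x (Suc k) - f k (x k, u k))))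
    + (1 / \<mu>) *\<^sub>R (case k of 0 \<Rightarrow> matrix_inv P *v (xhat0 - x 0)
        | Suc j \<Rightarrow> transpose (jacobian (h k) (at (x k))) *v (matrix_inv (R k) *v (y k - h k (x k)))
                 - matrix_inv (Q k) *v (x k - f j (x j, u j)))"

lemma objective_has_derivative_state:
  fixes f :: "nat \<Rightarrow> (real^'n) \<times> (real^'m) \<Rightarrow> real^'n" and h :: "nat \<Rightarrow> real^'n \<Rightarrow> real^'q"
  assumes "k < t" "t \<le> T" "\<mu> \<noteq> 0"
    and f_C2: "C2 (f k)" and l_C2: "C2 (l k)" and h_C2: "1 \<le> k \<Longrightarrow> C2 (h k)"
    and P: "transpose (matrix_inv P) = matrix_inv P"
    and Q: "\<And>j. 1 \<le> j \<Longrightarrow> j \<le> T \<Longrightarrow> transpose (matrix_inv (Q j)) = matrix_inv (Q j)"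
    and R: "\<And>j. 1 \<le> j \<Longrightarrow> j \<le> t \<Longrightarrow> transpose (matrix_inv (R j)) = matrix_inv (R j)"
  shows "((\<lambda>\<xi>. objective T t \<mu> f h l lT P Q R u y xhat0 (x(k := \<xi>)) v) has_derivative
     (\<lambda>d. state_gradient k \<mu> f h l P Q R u y xhat0 x \<bullet> d)) (at (x k))"
proof -
  define c where "c = (\<lambda>j. if j < t then u j else v j)"
  have ck: "c k = u k" and cj: "k = Suc j \<Longrightarrow> c j = u j" for j
    using \<open>k < t\<close> by (auto simp: c_def)
  define F where "F = jacobian (\<lambda>\<xi>. f k (\<xi>, u k)) (at (x k))"
  define H where "H = jacobian (h k) (at (x k))"
  have F: "((\<lambda>\<xi>. f k (\<xi>, u k)) has_derivative (\<lambda>d. F *v d)) (at (x k))"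
    unfolding F_def by (rule C2_has_derivative_jacobian[OF C2_fix_snd[OF f_C2]])
  have H: "(h k has_derivative (\<lambda>d. H *v d)) (at (x k))" if "1 \<le> k"
    unfolding H_def by (rule C2_has_derivative_jacobian[OF h_C2[OF that]])
  \<comment> \<open>The derivatives of the summands carry indicators, so that each sum over the
    stages collapses to the terms that contain \<open>x k\<close>.\<close>
  define Wl where "Wl = (\<lambda>j d. if j = k then grad (\<lambda>\<xi>. l k (\<xi>, u k)) (x k) \<bullet> d else 0)"
  define WR where "WR = (\<lambda>j d. if j = k
      then - 2 * ((H *v d) \<bullet> (matrix_inv (R k) *v (y k - h k (x k)))) else 0)"
  \<comment> \<open>The state \<open>x k\<close> enters two dynamics residuals: through
    \<open>f k\<close> in the one leaving stage \<open>k\<close>, and directly in the one arriving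
    from stage \<open>k - 1\<close>.\<close>
  define WQ where "WQ = (\<lambda>j d.
      (if j = k then - 2 * ((F *v d) \<bullet> (matrix_inv (Q (Suc k)) *v (x (Suc k) - f k (x k, u k)))) else 0)
      + (if Suc j = k then 2 * (d \<bullet> (matrix_inv (Q k) *v (x k - f j (x j, u j)))) else 0))"
  define WP where "WP = (\<lambda>d. if k = 0 then - 2 * (d \<bullet> (matrix_inv P *v (xhat0 - x 0))) else 0)"
  have l: "((\<lambda>\<xi>. l j ((x(k := \<xi>)) j, c j)) has_derivative Wl j) (at (x k))" if "j < T" for j
    using C2_has_derivative_grad[OF C2_fix_snd[OF l_C2]] by (cases "j = k") (auto simp: Wl_def ck)
  have r: "((\<lambda>\<xi>. (y j - h j ((x(k := \<xi>)) j)) \<bullet> (matrix_inv (R j) *v (y j - h j ((x(k := \<xi>)) j))))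
      has_derivative WR j) (at (x k))" if "j \<in> {1..t}" for j
  proof (cases "j = k")
    case True
    have "((\<lambda>\<xi>. y k - h k \<xi>) has_derivative (\<lambda>d. - (H *v d))) (at (x k))"
      using H that True by (auto intro!: derivative_eq_intros)
    from has_derivative_quadratic_form[OF this R] show ?thesis
      using True that by (simp add: WR_def)
  qed (simp add: WR_def)
  have q: "((\<lambda>\<xi>. ((x(k := \<xi>)) (Suc j) - f j ((x(k := \<xi>)) j, c j))
        \<bullet> (matrix_inv (Q (Suc j)) *v ((x(k := \<xi>)) (Suc j) - f j ((x(k := \<xi>)) j, c j))))
      has_derivative WQ j) (at (x k))" if "j < T" for j
  proof -
    consider "j = k" | "Suc j = k" | "j \<noteq> k" "Suc j \<noteq> k"
      by blast
    then show ?thesis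
    proof cases
      case 1
      have "((\<lambda>\<xi>. x (Suc k) - f k (\<xi>, u k)) has_derivative (\<lambda>d. - (F *v d))) (at (x k))"
        using F by (auto intro!: derivative_eq_intros)
      from has_derivative_quadratic_form[OF this Q[of "Suc k"]] show ?thesis
        using 1 that by (simp add: WQ_def ck)
    next
      case 2
      have "((\<lambda>\<xi>. \<xi> - f j (x j, u j)) has_derivative (\<lambda>d. d)) (at (x k))"
        by (auto intro!: derivative_eq_intros)
      from has_derivative_quadratic_form[OF this Q[of k]] show ?thesis
        using 2 that cj[of j] by (auto simp: WQ_def)
    qed (simp add: WQ_def)
  qed
  have p: "((\<lambda>\<xi>. ((x(k := \<xi>)) 0 - xhat0) \<bullet> (matrix_inv P *v ((x(k := \<xi>)) 0 - xhat0)))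
      has_derivative WP) (at (x k))"
  proof (cases "k = 0")
    case True
    have "((\<lambda>\<xi>. \<xi> - xhat0) has_derivative (\<lambda>d. d)) (at (x k))"
      by (auto intro!: derivative_eq_intros)
    from has_derivative_quadratic_form[OF this P] show ?thesis
      using True by (simp add: WP_def algebra_simps inner_diff_right)
  qed (simp add: WP_def)
  \<comment> \<open>Since \<open>k < t\<close> and \<open>t \<le> T\<close>, the terminal state is
    not the one being varied.\<close>
  have lT: "((\<lambda>\<xi>. lT ((x(k := \<xi>)) T)) has_derivative (\<lambda>d. 0)) (at (x k))"
    using \<open>k < t\<close> \<open>t \<le> T\<close> by simp
  have "((\<lambda>\<xi>. objective T t \<mu> f h l lT P Q R u y xhat0 (x(k := \<xi>)) v) has_derivative
      (\<lambda>d. (\<Sum>j<T. Wl j d) + 0 - 1 / (2 * \<mu>) * WP d - 1 / (2 * \<mu>) * (\<Sum>j = 1..t. WR j d)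
         - 1 / (2 * \<mu>) * (\<Sum>j<T. WQ j d))) (at (x k))"
    unfolding objective_def Let_def c_def[symmetric]
    by (intro has_derivative_add has_derivative_diff has_derivative_mult_right has_derivative_sum
        l r q p lT) auto
  moreover have "(\<Sum>j<T. Wl j d) + 0 - 1 / (2 * \<mu>) * WP d - 1 / (2 * \<mu>) * (\<Sum>j = 1..t. WR j d)
      - 1 / (2 * \<mu>) * (\<Sum>j<T. WQ j d) = state_gradient k \<mu> f h l P Q R u y xhat0 x \<bullet> d" for d
  proof -
    \<comment> \<open>Moving the Jacobians to the other side of the inner product turns the
      differential into a gradient paired with \<open>d\<close>.\<close>
    have adj: "(A *v d) \<bullet> b = (transpose A *v b) \<bullet> d" for A :: "real^'n^'b" and b
      by (metis dot_lmul_matrix inner_commute transpose_matrix_vector)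
    show ?thesis
      using \<open>k < t\<close> \<open>t \<le> T\<close> \<open>\<mu> \<noteq> 0\<close>
      by (cases k) (simp_all add: Wl_def WP_def WR_def WQ_def sum.distrib state_gradient_def adj
          F_def H_def field_simps inner_add_left inner_diff_left inner_commute[of d]
          del: transpose_matrix_vector)
  qed
  ultimately show ?thesis
    by simp
qed

text \<open>These are the blocks of row \<open>k\<close> of the Hessian. A single formula with
  indicators covers every column \<open>j\<close>, showing that only the diagonal and its two
  neighbours are nonzero.\<close>

lemma state_gradient_has_derivative:
  fixes f :: "nat \<Rightarrow> (real^'n) \<times> (real^'m) \<Rightarrow> real^'n" and h :: "nat \<Rightarrow> real^'n \<Rightarrow> real^'q"
    and l :: "nat \<Rightarrow> (real^'n) \<times> (real^'m) \<Rightarrow> real"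
    and x :: "nat \<Rightarrow> real^'n" and u :: "nat \<Rightarrow> real^'m"
  assumes f_C2: "\<And>j. j \<le> k \<Longrightarrow> C2 (f j)" and l_C2: "C2 (l k)" and h_C2: "1 \<le> k \<Longrightarrow> C2 (h k)"
  defines "F \<equiv> \<lambda>j. jacobian (\<lambda>\<xi>. f j (\<xi>, u j)) (at (x j))" and "H \<equiv> jacobian (h k) (at (x k))"
  shows "((\<lambda>\<xi>. state_gradient k \<mu> f h l P Q R u y xhat0 (x(j := \<xi>))) has_derivative
    (\<lambda>d. (if j = k then hessian (\<lambda>\<xi>. l k (\<xi>, u k)) (x k) *v d
            + (1 / \<mu>) *\<^sub>R (weighted_hessian (matrix_inv (Q (Suc k)) *v (x (Suc k) - f k (x k, u k)))
                              (\<lambda>\<xi>. f k (\<xi>, u k)) (x k) *v d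
                           - transpose (F k) *v (matrix_inv (Q (Suc k)) *v (F k *v d)))
            + (1 / \<mu>) *\<^sub>R (if k = 0 then - (matrix_inv P *v d)
                else weighted_hessian (matrix_inv (R k) *v (y k - h k (x k))) (h k) (x k) *v d
                   - transpose H *v (matrix_inv (R k) *v (H *v d)) - matrix_inv (Q k) *v d) else 0)
        + (if j = Suc k then (1 / \<mu>) *\<^sub>R (transpose (F k) *v (matrix_inv (Q (Suc k)) *v d)) else 0)
        + (if Suc j = k then (1 / \<mu>) *\<^sub>R (matrix_inv (Q k) *v (F j *v d)) else 0))) (at (x j))"
proof -
  have F: "((\<lambda>\<xi>. f j (\<xi>, u j)) has_derivative (\<lambda>d. F j *v d)) (at (x j))" if "j \<le> k" for j
    unfolding F_def by (rule C2_has_derivative_jacobian[OF C2_fix_snd[OF f_C2[OF that]]])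
  note matvec = bounded_linear.has_derivative[OF matrix_vector_mul_bounded_linear]
  consider "j = k" | "j = Suc k" | "Suc j = k" | "j \<noteq> k" "j \<noteq> Suc k" "Suc j \<noteq> k"
    by blast
  then show ?thesis
  proof cases
    case 1
    have l: "((\<lambda>\<xi>. grad (\<lambda>\<xi>. l k (\<xi>, u k)) \<xi>) has_derivative
        (\<lambda>d. hessian (\<lambda>\<xi>. l k (\<xi>, u k)) (x k) *v d)) (at (x k))"
      by (rule C2_grad_has_derivative_hessian[OF C2_fix_snd[OF l_C2]])
    note f = has_derivative_weighted_residual[OF C2_fix_snd[OF f_C2[of k]], of "u k"
        "matrix_inv (Q (Suc k))" "x (Suc k)" "x k", simplified order_refl True_implies_equals]
    have b: "((\<lambda>\<xi>. case k of 0 \<Rightarrow> matrix_inv P *v (xhat0 - \<xi>)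
        | Suc j \<Rightarrow> transpose (jacobian (h k) (at \<xi>)) *v (matrix_inv (R k) *v (y k - h k \<xi>))
                 - matrix_inv (Q k) *v (\<xi> - f j (x j, u j))) has_derivative
        (\<lambda>d. if k = 0 then - (matrix_inv P *v d)
          else weighted_hessian (matrix_inv (R k) *v (y k - h k (x k))) (h k) (x k) *v d
             - transpose H *v (matrix_inv (R k) *v (H *v d)) - matrix_inv (Q k) *v d)) (at (x k))"
    proof (cases k)
      case 0
      have "((\<lambda>\<xi>. matrix_inv P *v (xhat0 - \<xi>)) has_derivative (\<lambda>d. matrix_inv P *v (0 - d))) (at (x k))"
        by (intro matvec has_derivative_diff has_derivative_const has_derivative_ident)
      then show ?thesis
        using 0 by (simp add: linear_neg)
    next
      case (Suc i)
      have "((\<lambda>\<xi>. transpose (jacobian (h k) (at \<xi>)) *v (matrix_inv (R k) *v (y k - h k \<xi>))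
                 - matrix_inv (Q k) *v (\<xi> - f i (x i, u i))) has_derivative
        (\<lambda>d. weighted_hessian (matrix_inv (R k) *v (y k - h k (x k))) (h k) (x k) *v d
             - transpose H *v (matrix_inv (R k) *v (H *v d)) - matrix_inv (Q k) *v (d - 0))) (at (x k))"
        unfolding H_def using Suc
        by (intro has_derivative_diff has_derivative_weighted_residual h_C2 matvec
            has_derivative_const has_derivative_ident) simp
      then show ?thesis
        using Suc by (simp del: transpose_matrix_vector)
    qed
    \<comment> \<open>Along \<open>x(k := \<xi>)\<close> the neighbouring states stay fixed;
      spelling this out isolates the dependence on \<open>\<xi>\<close>.\<close>
    have sg: "state_gradient k \<mu> f h l P Q R u y xhat0 (x(k := \<xi>)) =
        grad (\<lambda>\<xi>. l k (\<xi>, u k)) \<xi>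
        + (1 / \<mu>) *\<^sub>R (transpose (jacobian (\<lambda>\<xi>. f k (\<xi>, u k)) (at \<xi>))
                     *v (matrix_inv (Q (Suc k)) *v (x (Suc k) - f k (\<xi>, u k))))
        + (1 / \<mu>) *\<^sub>R (case k of 0 \<Rightarrow> matrix_inv P *v (xhat0 - \<xi>)
            | Suc j \<Rightarrow> transpose (jacobian (h k) (at \<xi>)) *v (matrix_inv (R k) *v (y k - h k \<xi>))
                 - matrix_inv (Q k) *v (\<xi> - f j (x j, u j)))" for \<xi>
      by (cases k) (simp_all add: state_gradient_def del: transpose_matrix_vector)
    have "((\<lambda>\<xi>. state_gradient k \<mu> f h l P Q R u y xhat0 (x(k := \<xi>))) has_derivative
      (\<lambda>d. hessian (\<lambda>\<xi>. l k (\<xi>, u k)) (x k) *v d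
            + (1 / \<mu>) *\<^sub>R (weighted_hessian (matrix_inv (Q (Suc k)) *v (x (Suc k) - f k (x k, u k)))
                              (\<lambda>\<xi>. f k (\<xi>, u k)) (x k) *v d
                           - transpose (F k) *v (matrix_inv (Q (Suc k)) *v (F k *v d)))
            + (1 / \<mu>) *\<^sub>R (if k = 0 then - (matrix_inv P *v d)
                else weighted_hessian (matrix_inv (R k) *v (y k - h k (x k))) (h k) (x k) *v d
                   - transpose H *v (matrix_inv (R k) *v (H *v d)) - matrix_inv (Q k) *v d))) (at (x k))"
      unfolding sg F_def
      by (intro has_derivative_add has_derivative_scaleR_right l f b)
    then show ?thesis
      unfolding 1 by (simp del: transpose_matrix_vector)
  next
    case 2
    have "((\<lambda>\<xi>. transpose (F k) *v (matrix_inv (Q (Suc k)) *v (\<xi> - f k (x k, u k)))) has_derivative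
       (\<lambda>d. transpose (F k) *v (matrix_inv (Q (Suc k)) *v (d - 0)))) (at (x j))"
      by (intro matvec has_derivative_diff has_derivative_const has_derivative_ident)
    \<comment> \<open>The constant slots are the terms without \<open>x (Suc k)\<close>: the stage
      cost gradient and the final bracket.\<close>
    from has_derivative_add[OF has_derivative_add[OF has_derivative_const
          has_derivative_scaleR_right[OF this]] has_derivative_const]
    show ?thesis
      unfolding state_gradient_def using 2
      by (cases k) (simp_all add: F_def del: transpose_matrix_vector)
  next
    case 3
    \<comment> \<open>The preceding state occurs only inside \<open>f j\<close>; \<open>a\<close>
      and \<open>b\<close> abstract all that does not depend on it.\<close>
    have "((\<lambda>\<xi>. a + (1 / \<mu>) *\<^sub>R (b - matrix_inv (Q k) *v (x k - f j (\<xi>, u j)))) has_derivative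
        (\<lambda>d. 0 + (1 / \<mu>) *\<^sub>R (0 - matrix_inv (Q k) *v (0 - F j *v d)))) (at (x j))" for a b
      using 3
      by (intro matvec has_derivative_add has_derivative_diff has_derivative_scaleR_right
          has_derivative_const F) simp
    then show ?thesis
      unfolding state_gradient_def using 3
      by (auto simp: linear_neg simp del: transpose_matrix_vector)
  next
    case 4
    then show ?thesis
      unfolding state_gradient_def by (cases k) (auto simp del: transpose_matrix_vector)
  qed
qed

text \<open>The scalar rows of block \<open>k\<close> are gathered into one vector equation and
  multiplied by the nonzero \<open>\<mu>\<close>, which clears the weights
  \<open>1 / \<mu>\<close>.\<close>

lemma newton_row_state:
  fixes f :: "nat \<Rightarrow> (real^'n) \<times> (real^'m) \<Rightarrow> real^'n" and h :: "nat \<Rightarrow> real^'n \<Rightarrow> real^'q"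
    and l :: "nat \<Rightarrow> (real^'n) \<times> (real^'m) \<Rightarrow> real" and x px :: "nat \<Rightarrow> real^'n"
    and u :: "nat \<Rightarrow> real^'m" and y :: "nat \<Rightarrow> real^'q"
  assumes "k < t" "t \<le> T" "\<mu> \<noteq> 0"
    and f_C2: "\<And>j. j \<le> k \<Longrightarrow> C2 (f j)" and l_C2: "C2 (l k)" and h_C2: "1 \<le> k \<Longrightarrow> C2 (h k)"
    and P: "transpose (matrix_inv P) = matrix_inv P"
    and Q: "\<And>j. 1 \<le> j \<Longrightarrow> j \<le> T \<Longrightarrow> transpose (matrix_inv (Q j)) = matrix_inv (Q j)"
    and R: "\<And>j. 1 \<le> j \<Longrightarrow> j \<le> t \<Longrightarrow> transpose (matrix_inv (R j)) = matrix_inv (R j)"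
  defines "F \<equiv> \<lambda>j. jacobian (\<lambda>\<xi>. f j (\<xi>, u j)) (at (x j))" and "H \<equiv> jacobian (h k) (at (x k))"
    and "w \<equiv> \<lambda>j. x (Suc j) - f j (x j, u j)" and "\<gamma> \<equiv> y k - h k (x k)"
  shows "(\<forall>i. newton_row (decision_vars T t)
            (on_coords (objective T t \<mu> f h l lT P Q R u y xhat0)) (pack x v) (pack px pu) (Xvar k i))
     \<longleftrightarrow> \<mu> *\<^sub>R (hessian (\<lambda>\<xi>. l k (\<xi>, u k)) (x k) *v px k)
         + weighted_hessian (matrix_inv (Q (Suc k)) *v w k) (\<lambda>\<xi>. f k (\<xi>, u k)) (x k) *v px k
         - transpose (F k) *v (matrix_inv (Q (Suc k)) *v (F k *v px k))
         + transpose (F k) *v (matrix_inv (Q (Suc k)) *v px (Suc k))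
         + (case k of 0 \<Rightarrow> - (matrix_inv P *v px 0)
            | Suc j \<Rightarrow> weighted_hessian (matrix_inv (R k) *v \<gamma>) (h k) (x k) *v px k
                - transpose H *v (matrix_inv (R k) *v (H *v px k)) - matrix_inv (Q k) *v px k
                + matrix_inv (Q k) *v (F j *v px j))
       = - (\<mu> *\<^sub>R grad (\<lambda>\<xi>. l k (\<xi>, u k)) (x k)
            + transpose (F k) *v (matrix_inv (Q (Suc k)) *v w k)
            + (case k of 0 \<Rightarrow> matrix_inv P *v (xhat0 - x 0)
               | Suc j \<Rightarrow> transpose H *v (matrix_inv (R k) *v \<gamma>) - matrix_inv (Q k) *v w j))"
    (is "?newton \<longleftrightarrow> ?lhs = - ?rhs")
proof -
  let ?G = "state_gradient k \<mu> f h l P Q R u y xhat0"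
  define D where "D = (\<lambda>j d. (if j = k then hessian (\<lambda>\<xi>. l k (\<xi>, u k)) (x k) *v d
            + (1 / \<mu>) *\<^sub>R (weighted_hessian (matrix_inv (Q (Suc k)) *v w k)
                              (\<lambda>\<xi>. f k (\<xi>, u k)) (x k) *v d
                           - transpose (F k) *v (matrix_inv (Q (Suc k)) *v (F k *v d)))
            + (1 / \<mu>) *\<^sub>R (if k = 0 then - (matrix_inv P *v d)
                else weighted_hessian (matrix_inv (R k) *v \<gamma>) (h k) (x k) *v d
                   - transpose H *v (matrix_inv (R k) *v (H *v d)) - matrix_inv (Q k) *v d) else 0)
        + (if j = Suc k then (1 / \<mu>) *\<^sub>R (transpose (F k) *v (matrix_inv (Q (Suc k)) *v d)) else 0)
        + (if Suc j = k then (1 / \<mu>) *\<^sub>R (matrix_inv (Q k) *v (F j *v d)) else 0))"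
  have G: "((\<lambda>\<xi>. ?G (x(j := \<xi>))) has_derivative D j) (at (x j))" for j
    unfolding D_def F_def H_def w_def \<gamma>_def
    by (rule state_gradient_has_derivative) (fact f_C2 l_C2 h_C2)+
  have "?newton \<longleftrightarrow> (\<Sum>j\<le>T. D j (px j)) = - ?G x"
    unfolding vec_eq_iff
    by (intro all_cong1 newton_row_Xvar objective_has_derivative_state G) (use assms in auto)
  also have "\<dots> \<longleftrightarrow> \<mu> *\<^sub>R (\<Sum>j\<le>T. D j (px j)) = - (\<mu> *\<^sub>R ?G x)"
    using \<open>\<mu> \<noteq> 0\<close> by (simp flip: scaleR_minus_right)
  also have "\<mu> *\<^sub>R ?G x = ?rhs"
    unfolding state_gradient_def F_def H_def w_def \<gamma>_def using \<open>\<mu> \<noteq> 0\<close>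
    by (simp add: scaleR_add_right del: transpose_matrix_vector split: nat.split)
  \<comment> \<open>From \<open>k < t\<close> and \<open>t \<le> T\<close> it follows that
    \<open>Suc k \<le> T\<close>, so the right neighbour lies in the range of the sum.\<close>
  also have "\<mu> *\<^sub>R (\<Sum>j\<le>T. D j (px j)) = ?lhs"
    using \<open>k < t\<close> \<open>t \<le> T\<close> \<open>\<mu> \<noteq> 0\<close>
    by (cases k) (simp_all add: D_def sum.distrib scaleR_add_right scaleR_diff_right del: transpose_matrix_vector)
  finally show ?thesis .
qed

section \<open>Block forward elimination along the past states\<close>

theorem proposition2:
  fixes T t :: nat and \<mu> :: real
    and f :: "nat \<Rightarrow> (real^'n) \<times> (real^'m) \<Rightarrow> real^'n"
    and h :: "nat \<Rightarrow> real^'n \<Rightarrow> real^'q"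
    and l :: "nat \<Rightarrow> (real^'n) \<times> (real^'m) \<Rightarrow> real" and lT :: "real^'n \<Rightarrow> real"
    and P :: "real^'n^'n" and Q :: "nat \<Rightarrow> real^'n^'n" and R :: "nat \<Rightarrow> real^'q^'q"
    and u :: "nat \<Rightarrow> real^'m" and y :: "nat \<Rightarrow> real^'q" and xhat0 :: "real^'n"
    and xi :: "nat \<Rightarrow> real^'n" and ui :: "nat \<Rightarrow> real^'m"
    and w :: "nat \<Rightarrow> real^'n" and \<gamma> :: "nat \<Rightarrow> real^'q"
    and fx :: "nat \<Rightarrow> real^'n^'n" and hx :: "nat \<Rightarrow> real^'n^'q"
    and lx :: "nat \<Rightarrow> real^'n" and lbar_xx :: "nat \<Rightarrow> real^'n^'n"
    and E Pbar Pk :: "nat \<Rightarrow> real^'n^'n" and K :: "nat \<Rightarrow> real^'q^'n"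
    and \<mu>hat :: "nat \<Rightarrow> real^'n"
    and px :: "nat \<Rightarrow> real^'n" and pu :: "nat \<Rightarrow> real^'m"
  assumes "1 \<le> T" and "t \<le> T" and "0 < \<mu>" and "1 \<le> t"
    and f_C2: "\<And>j. j < T \<Longrightarrow> C2 (f j)"
    and h_C2: "\<And>j. 1 \<le> j \<Longrightarrow> j \<le> t \<Longrightarrow> C2 (h j)"
    and l_C2: "\<And>j. j < T \<Longrightarrow> C2 (l j)"
    and lT_C2: "C2 lT"
    and P_pos: "pos_def P"
    and Q_pos: "\<And>j. 1 \<le> j \<Longrightarrow> j \<le> T \<Longrightarrow> pos_def (Q j)"
    and R_pos: "\<And>j. 1 \<le> j \<Longrightarrow> j \<le> t \<Longrightarrow> pos_def (R j)"
    and ui_past: "\<And>k. k < t \<Longrightarrow> ui k = u k"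
    and w_eq: "\<And>k. k < T \<Longrightarrow> w (k + 1) = xi (k + 1) - f k (xi k, ui k)"
    and \<gamma>_eq: "\<And>k. 1 \<le> k \<Longrightarrow> k \<le> t \<Longrightarrow> \<gamma> k = y k - h k (xi k)"
    and fx_eq: "\<And>k. k < T \<Longrightarrow> fx k = jacobian (\<lambda>x. f k (x, ui k)) (at (xi k))"
    and hx_eq: "\<And>k. 1 \<le> k \<Longrightarrow> k \<le> t \<Longrightarrow> hx k = jacobian (h k) (at (xi k))"
    and lx_eq: "\<And>k. k < T \<Longrightarrow> lx k = grad (\<lambda>x. l k (x, ui k)) (xi k)"
    and lbar_eq: "\<And>k. k < T \<Longrightarrow> lbar_xx k =
          hessian (\<lambda>x. l k (x, ui k)) (xi k)
          + (1 / \<mu>) *\<^sub>R weighted_hessian (w (k + 1) v* matrix_inv (Q (k + 1)))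
                          (\<lambda>x. f k (x, ui k)) (xi k)
          + (if 1 \<le> k \<and> k \<le> t
             then (1 / \<mu>) *\<^sub>R weighted_hessian (\<gamma> k v* matrix_inv (R k)) (h k) (xi k)
             else 0)"
    and Pk_0: "Pk 0 = P"
    and \<mu>hat_0: "\<mu>hat 0 = xhat0 - xi 0"
    and E_rec: "\<And>k. k < t \<Longrightarrow> E (k + 1) =
          matrix_inv (Pk k) + transpose (fx k) ** matrix_inv (Q (k + 1)) ** fx k
          - \<mu> *\<^sub>R lbar_xx k"
    and Pbar_rec: "\<And>k. k < t \<Longrightarrow> Pbar (k + 1) =
          Q (k + 1) + fx k ** matrix_inv (matrix_inv (Pk k) - \<mu> *\<^sub>R lbar_xx k) ** transpose (fx k)"
    and K_rec: "\<And>k. k < t \<Longrightarrow> K (k + 1) =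
          Pbar (k + 1) ** transpose (hx (k + 1))
          ** matrix_inv (R (k + 1) + hx (k + 1) ** Pbar (k + 1) ** transpose (hx (k + 1)))"
    and Pk_rec: "\<And>k. k < t \<Longrightarrow> Pk (k + 1) = (mat 1 - K (k + 1) ** hx (k + 1)) ** Pbar (k + 1)"
    and \<mu>hat_rec: "\<And>k. k < t \<Longrightarrow> \<mu>hat (k + 1) =
          (mat 1 - K (k + 1) ** hx (k + 1)) *v (fx k *v \<mu>hat k - w (k + 1))
          + K (k + 1) *v \<gamma> (k + 1)
          + \<mu> *\<^sub>R ((Pk (k + 1) ** matrix_inv (Q (k + 1)) ** fx k ** matrix_inv (E (k + 1)))
                   *v (lbar_xx k *v \<mu>hat k + lx k))"
    and Pk_inv: "\<And>k. k < t \<Longrightarrow> invertible (Pk k)"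
    and Pk_lbar_inv: "\<And>k. k < t \<Longrightarrow> invertible (matrix_inv (Pk k) - \<mu> *\<^sub>R lbar_xx k)"
    and E_inv: "\<And>k. k < t \<Longrightarrow> invertible (E (k + 1))"
    and S_inv: "\<And>k. k < t \<Longrightarrow>
          invertible (R (k + 1) + hx (k + 1) ** Pbar (k + 1) ** transpose (hx (k + 1)))"
  shows "(\<forall>k<t. \<forall>i. newton_row (decision_vars T t)
            (on_coords (objective T t \<mu> f h l lT P Q R u y xhat0))
            (pack xi ui) (pack px pu) (Xvar k i))
     \<longleftrightarrow> (\<forall>k<t. px k = matrix_inv (E (k + 1)) *v
            (transpose (fx k) *v (matrix_inv (Q (k + 1)) *v (w (k + 1) + px (k + 1)))
             + matrix_inv (Pk k) *v \<mu>hat k + \<mu> *\<^sub>R lx k))"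
proof -
  define row where "row k \<longleftrightarrow> (\<forall>i. newton_row (decision_vars T t)
      (on_coords (objective T t \<mu> f h l lT P Q R u y xhat0)) (pack xi ui) (pack px pu) (Xvar k i))" for k
  define sol where "sol k \<longleftrightarrow> px k = matrix_inv (E (k + 1)) *v
      (transpose (fx k) *v (matrix_inv (Q (k + 1)) *v (w (k + 1) + px (k + 1)))
       + matrix_inv (Pk k) *v \<mu>hat k + \<mu> *\<^sub>R lx k)" for k
  have Q_sym: "transpose (matrix_inv (Q j)) = matrix_inv (Q j)" if "1 \<le> j" "j \<le> T" for j
    using pos_def_inv_symmetric[OF Q_pos] that .
  have R_sym: "transpose (matrix_inv (R j)) = matrix_inv (R j)" if "1 \<le> j" "j \<le> t" for j
    using pos_def_inv_symmetric[OF R_pos] that .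
  have f_past: "f k (xi k, u k) = xi (k + 1) - w (k + 1)"
      "jacobian (\<lambda>x. f k (x, u k)) (at (xi k)) = fx k"
      "grad (\<lambda>x. l k (x, u k)) (xi k) = lx k" if "k < t" for k
    using ui_past[OF that] w_eq[of k] fx_eq[of k] lx_eq[of k] that \<open>t \<le> T\<close> by simp_all
  \<comment> \<open>All second-order terms of row \<open>k\<close> are bundled in
    \<open>lbar_xx k\<close>. Symmetry of the inverse weights turns the row-vector weights
    \<open>v*\<close> into the column ones of the Newton row.\<close>
  have lbar: "\<mu> *\<^sub>R (lbar_xx k *v d) = \<mu> *\<^sub>R (hessian (\<lambda>x. l k (x, u k)) (xi k) *v d)
      + weighted_hessian (matrix_inv (Q (k + 1)) *v w (k + 1)) (\<lambda>x. f k (x, u k)) (xi k) *v d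
      + (if k = 0 then 0 else weighted_hessian (matrix_inv (R k) *v \<gamma> k) (h k) (xi k) *v d)"
    if "k < t" for k d
  proof -
    have vQ: "a v* matrix_inv (Q (k + 1)) = matrix_inv (Q (k + 1)) *v a" for a
      using Q_sym[of "k + 1"] that \<open>t \<le> T\<close> transpose_matrix_vector[of "matrix_inv (Q (k + 1))" a]
      by simp
    have vR: "a v* matrix_inv (R k) = matrix_inv (R k) *v a" if "k \<noteq> 0" for a
      using R_sym[of k] that \<open>k < t\<close> transpose_matrix_vector[of "matrix_inv (R k)" a] by simp
    have "k < T"
      using that \<open>t \<le> T\<close> by simp
    then show ?thesis
      unfolding lbar_eq[OF \<open>k < T\<close>] ui_past[OF that] vQ using that \<open>0 < \<mu>\<close>
      by (simp add: vR matrix_vector_mult_add_rdistrib scaleR_add_right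
          flip: scaleR_matrix_vector_assoc)
  qed
  have row_iff: "row k \<longleftrightarrow> \<mu> *\<^sub>R (lbar_xx k *v px k)
         - transpose (fx k) *v (matrix_inv (Q (Suc k)) *v (fx k *v px k))
         + transpose (fx k) *v (matrix_inv (Q (Suc k)) *v px (Suc k))
         + (case k of 0 \<Rightarrow> - (matrix_inv P *v px 0)
            | Suc j \<Rightarrow> matrix_inv (Q k) *v (fx j *v px j) - matrix_inv (Q k) *v px k
                - transpose (hx k) *v (matrix_inv (R k) *v (hx k *v px k)))
       = - (\<mu> *\<^sub>R lx k + transpose (fx k) *v (matrix_inv (Q (Suc k)) *v w (Suc k))
            + (case k of 0 \<Rightarrow> matrix_inv P *v \<mu>hat 0
               | Suc j \<Rightarrow> transpose (hx k) *v (matrix_inv (R k) *v \<gamma> k) - matrix_inv (Q k) *v w k))"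
    if "k < t" for k
  proof -
    have "row k \<longleftrightarrow> \<mu> *\<^sub>R (hessian (\<lambda>\<xi>. l k (\<xi>, u k)) (xi k) *v px k)
         + weighted_hessian (matrix_inv (Q (Suc k)) *v (xi (Suc k) - f k (xi k, u k)))
             (\<lambda>\<xi>. f k (\<xi>, u k)) (xi k) *v px k
         - transpose (fx k) *v (matrix_inv (Q (Suc k)) *v (fx k *v px k))
         + transpose (fx k) *v (matrix_inv (Q (Suc k)) *v px (Suc k))
         + (case k of 0 \<Rightarrow> - (matrix_inv P *v px 0)
            | Suc j \<Rightarrow> weighted_hessian (matrix_inv (R k) *v (y k - h k (xi k))) (h k) (xi k) *v px k
                - transpose (jacobian (h k) (at (xi k)))
                    *v (matrix_inv (R k) *v (jacobian (h k) (at (xi k)) *v px k))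
                - matrix_inv (Q k) *v px k
                + matrix_inv (Q k) *v (jacobian (\<lambda>\<xi>. f j (\<xi>, u j)) (at (xi j)) *v px j))
       = - (\<mu> *\<^sub>R lx k
            + transpose (fx k) *v (matrix_inv (Q (Suc k)) *v (xi (Suc k) - f k (xi k, u k)))
            + (case k of 0 \<Rightarrow> matrix_inv P *v (xhat0 - xi 0)
               | Suc j \<Rightarrow> transpose (jacobian (h k) (at (xi k)))
                    *v (matrix_inv (R k) *v (y k - h k (xi k)))
                  - matrix_inv (Q k) *v (xi (Suc j) - f j (xi j, u j))))"
      unfolding row_def f_past(2,3)[OF that, symmetric]
      by (rule newton_row_state)
        (use that \<open>t \<le> T\<close> \<open>0 < \<mu>\<close> f_C2 l_C2 h_C2 pos_def_inv_symmetric[OF P_pos] Q_sym R_sym in auto)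
    then show ?thesis
      using that lbar[OF that, of "px k"] f_past(1)[OF that]
      by (cases k) (simp_all add: f_past \<mu>hat_0 algebra_simps
          del: transpose_matrix_vector matrix_vector_right_distrib matrix_vector_mult_diff_distrib
          flip: \<gamma>_eq hx_eq)
  qed
  \<comment> \<open>Multiplying by the invertible \<open>E (k + 1)\<close> loses nothing and puts
    the claimed formula in the shape of a row.\<close>
  have sol_iff: "sol k \<longleftrightarrow> E (k + 1) *v px k =
      transpose (fx k) *v (matrix_inv (Q (k + 1)) *v (w (k + 1) + px (k + 1)))
       + matrix_inv (Pk k) *v \<mu>hat k + \<mu> *\<^sub>R lx k" if "k < t" for k
    unfolding sol_def using matrix_inv_mult_vector[OF E_inv[OF that]] by metis
  have E_vec: "E (k + 1) *v d = matrix_inv (Pk k) *v d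
      + transpose (fx k) *v (matrix_inv (Q (k + 1)) *v (fx k *v d)) - \<mu> *\<^sub>R (lbar_xx k *v d)"
    if "k < t" for k d
    unfolding E_rec[OF that]
    by (simp add: matrix_vector_mult_add_rdistrib matrix_vector_mult_diff_rdistrib
        del: transpose_matrix_vector flip: matrix_vector_mul_assoc scaleR_matrix_vector_assoc)
  have "row 0 \<longleftrightarrow> sol 0"
  proof -
    have "0 < t"
      using \<open>1 \<le> t\<close> by simp
    show ?thesis
      unfolding row_iff[OF \<open>0 < t\<close>] sol_iff[OF \<open>0 < t\<close>] E_vec[OF \<open>0 < t\<close>]
      by (auto simp: Pk_0 algebra_simps simp del: transpose_matrix_vector)
  qed
  \<comment> \<open>Inserting \<open>sol k\<close> for \<open>px k\<close> in the coupling term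
    leaves only \<open>px (Suc k)\<close> and \<open>px (Suc (Suc k))\<close>. The coefficient of
    the former assembles \<open>matrix_inv (Pk (Suc k))\<close>, the constants assemble its product
    with \<open>\<mu>hat (Suc k)\<close>.\<close>
  moreover have "row (Suc k) \<longleftrightarrow> sol (Suc k)" if "Suc k < t" "sol k" for k
  proof -
    have "k < t"
      using that by simp
    then have inv: "invertible (Q (k + 1))" "invertible (R (k + 1))"
      using pos_def_invertible Q_pos[of "k + 1"] R_pos[of "k + 1"] \<open>t \<le> T\<close> by auto
    note step = kalman_information_step[OF inv Pk_lbar_inv[OF \<open>k < t\<close>] E_inv[OF \<open>k < t\<close>]
        S_inv[OF \<open>k < t\<close>] E_rec[OF \<open>k < t\<close>] Pbar_rec[OF \<open>k < t\<close>] K_rec[OF \<open>k < t\<close>]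
        Pk_rec[OF \<open>k < t\<close>] \<mu>hat_rec[OF \<open>k < t\<close>]]
    have P_vec: "matrix_inv (Pk (Suc k)) *v d = matrix_inv (Q (Suc k)) *v d
        - matrix_inv (Q (Suc k)) *v (fx k *v (matrix_inv (E (Suc k)) *v
            (transpose (fx k) *v (matrix_inv (Q (Suc k)) *v d))))
        + transpose (hx (Suc k)) *v (matrix_inv (R (Suc k)) *v (hx (Suc k) *v d))" for d
      using step(1)
      by (simp add: matrix_vector_mult_add_rdistrib matrix_vector_mult_diff_rdistrib
        del: transpose_matrix_vector flip: matrix_vector_mul_assoc)
    show ?thesis
      unfolding row_iff[OF \<open>Suc k < t\<close>] sol_iff[OF \<open>Suc k < t\<close>] E_vec[OF \<open>Suc k < t\<close>]
        P_vec[of "px (Suc k)"] step(2)[unfolded Suc_eq_plus1[symmetric]]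
        nat.case \<open>sol k\<close>[unfolded sol_def]
      by (auto simp: algebra_simps simp del: transpose_matrix_vector)
  qed
  \<comment> \<open>The step from \<open>row\<close> to \<open>sol\<close> at \<open>Suc k\<close>
    relies on \<open>sol k\<close>, so the induction compares whole prefixes of rows.\<close>
  ultimately have "(\<forall>k<n. row k) \<longleftrightarrow> (\<forall>k<n. sol k)" if "n \<le> t" for n
    using that
  proof (induction n)
    case (Suc n)
    then show ?case
      by (cases n) (auto simp: less_Suc_eq)
  qed simp
  from this[of t] show ?thesis
    by (simp add: row_def sol_def)
qed

end
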